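(* Let $n\ge 2$ be an integer, $\lambda\in\mathbb{R}$, $\varepsilon>0$ and $c_0>0$. Suppose $h\in C^2((0,\varepsilon))$ satisfies $h(r)>0$ and $$2r^2h(r)h_{rr}(r)=(n-1)h(r)(h(r)-1)+rh_r(r)\big(rh_r(r)-\lambda r-(n-1)\big)\quad\text{for all } r\in(0,\varepsilon),$$ and $\lim_{r\to0^+}r^{\alpha}h(r)=c_0$ for some constant $\alpha>0$. Then $\alpha=\sqrt{n}-1$.
   Context: Subscripts $r$ denote derivatives with respect to $r$. *)

theory Defs
  imports "HOL-Analysis.Analysis"
begin

(* Intended for open S only: derivatives are taken in full neighbourhoods of the points of S. *)
definition C2_on :: "real set \<Rightarrow> (real \<Rightarrow> real) \<Rightarrow> bool" where
  "C2_on S f \<longleftrightarrow>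
     (\<forall>x\<in>S. f field_differentiable (at x)) \<and>
     (\<forall>x\<in>S. deriv f field_differentiable (at x)) \<and>
     continuous_on S (deriv (deriv f))"

end

theory Submission
  imports Defs
begin

text \<open>
  Put \<open>s = sqrt n\<close> and \<open>y = sqrt h\<close>, and let \<open>D = r d/dr\<close>. The equation becomes
  \<open>D\<^sup>2 y - D y - (n - 1) y / 4 = D F + O(1/y)\<close> with \<open>F = (\<lambda> r + n - 1) / (2 y)\<close>, and the operator
  on the left factors as \<open>(D - (1 + s)/2) (D - (1 - s)/2)\<close>. Hence \<open>v = D y - (1 - s)/2 y - F\<close>
  satisfies \<open>D v = (1 + s)/2 v + O(1)\<close>. As the coefficient of \<open>v\<close> is positive, \<open>v\<close> stays bounded
  as \<open>r \<rightarrow> 0\<close>. Dividing by \<open>y \<rightarrow> \<infinity>\<close> gives \<open>r h' / h \<rightarrow> 1 - s\<close>, which must be \<open>- \<alpha>\<close>.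
\<close>

text \<open>Integrating factor: \<open>r powr (-m) * (v r + K / m)\<close> has derivative
  \<open>r powr (-m - 1) * (r * v' r - m * v r - K)\<close>, which is nonpositive. The function is
  therefore nonincreasing, and its value at \<open>r\<close> dominates its value at
  \<open>d\<close>.\<close>

lemma euler_first_order_lower_bound:
  fixes v v' :: "real \<Rightarrow> real"
  assumes m: "m > 0" and K: "K \<ge> 0"
    and der: "\<And>r. \<lbrakk>0 < r; r \<le> d\<rbrakk> \<Longrightarrow> (v has_real_derivative v' r) (at r)"
    and bound: "\<And>r. \<lbrakk>0 < r; r \<le> d\<rbrakk> \<Longrightarrow> r * v' r - m * v r \<le> K"
    and r: "0 < r" "r \<le> d"
  shows "v r \<ge> - (\<bar>v d\<bar> + K / m)"
proof -
  define z where "z = (\<lambda>r. r powr (-m) * (v r + K / m))"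
  have "z d \<le> z r"
  proof (rule DERIV_nonpos_imp_nonincreasing[OF r(2)])
    fix x assume x: "r \<le> x" "x \<le> d"
    with r have x0: "x > 0" by simp
    have "(z has_real_derivative
        (-m * x powr (-m - 1)) * (v x + K / m) + v' x * x powr (-m)) (at x)"
      unfolding z_def using x0 m der[OF x0 x(2)]
      by (auto intro!: derivative_eq_intros simp: algebra_simps)
    moreover have "(-m * x powr (-m - 1)) * (v x + K / m) + v' x * x powr (-m)
        = x powr (-m - 1) * (x * v' x - m * v x - K)"
      using x0 m by (simp add: powr_diff field_simps)
    moreover have "\<dots> \<le> 0"
      using bound[OF x0 x(2)] by (intro mult_nonneg_nonpos) auto
    ultimately show "\<exists>y. (z has_real_derivative y) (at x) \<and> y \<le> 0"
      by auto
  qed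
  then have "r powr m * z d \<le> r powr m * z r"
    by (rule mult_left_mono) simp
  moreover have "r powr m * z r = v r + K / m"
    using r by (simp add: z_def powr_minus)
  moreover have "r powr m * z d = (r powr m * d powr (-m)) * (v d + K / m)"
    by (simp add: z_def)
  \<comment> \<open>The factor is (r/d)^m, which lies in [0, 1] because r \<le> d and m > 0. This
    makes the bound uniform as r tends to 0.\<close>
  moreover have "(r powr m * d powr (-m)) * (v d + K / m) \<ge> - \<bar>v d\<bar>"
  proof -
    let ?q = "r powr m * d powr (-m)"
    have q: "0 \<le> ?q" "?q \<le> 1"
      using r m powr_mono2[of m r d] by (auto simp: powr_minus field_simps)
    have "- \<bar>v d\<bar> \<le> ?q * - \<bar>v d\<bar>"
      using q mult_right_mono[of ?q 1 "\<bar>v d\<bar>"] by simp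
    also have "\<dots> \<le> ?q * (v d + K / m)"
    proof (rule mult_left_mono[OF _ q(1)])
      have "K / m \<ge> 0" using K m by simp
      then show "- \<bar>v d\<bar> \<le> v d + K / m" by linarith
    qed
    finally show ?thesis .
  qed
  ultimately show ?thesis by linarith
qed

text \<open>Apply the one-sided estimate to \<open>v\<close> and to \<open>- v\<close>. The sign of
  \<open>m\<close> is decisive: the homogeneous solutions r^m stay bounded near 0.\<close>

lemma euler_first_order_bounded:
  fixes v v' :: "real \<Rightarrow> real"
  assumes m: "m > 0"
    and der: "\<And>r. \<lbrakk>0 < r; r \<le> d\<rbrakk> \<Longrightarrow> (v has_real_derivative v' r) (at r)"
    and bound: "\<And>r. \<lbrakk>0 < r; r \<le> d\<rbrakk> \<Longrightarrow> \<bar>r * v' r - m * v r\<bar> \<le> K"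
    and r: "0 < r" "r \<le> d"
  shows "\<bar>v r\<bar> \<le> \<bar>v d\<bar> + K / m"
proof -
  have K: "K \<ge> 0"
    using bound[OF r] by linarith
  have "v r \<ge> - (\<bar>v d\<bar> + K / m)"
    by (rule euler_first_order_lower_bound[OF m K der _ r]) (use bound in \<open>auto simp: abs_le_iff\<close>)
  moreover have "- v r \<ge> - (\<bar>- v d\<bar> + K / m)"
  proof (rule euler_first_order_lower_bound[OF m K _ _ r, where v' = "\<lambda>r. - v' r"])
    fix x assume x: "0 < x" "x \<le> d"
    show "((\<lambda>r. - v r) has_real_derivative - v' x) (at x)"
      using der[OF x] by (rule DERIV_minus)
    show "x * - v' x - m * - v x \<le> K"
      using bound[OF x] by (simp add: abs_le_iff)
  qed
  ultimately show ?thesis by simp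
qed

text \<open>With y = sqrt h one has D y = r h' / (2 y), so the quotient is v = D y - (1 - s)/2 y - F
  over the common denominator 2 y. The claim is D v = (1 + s)/2 v plus an explicit multiple of 1/y,
  divided by r. Writing n as \<open>s\<^sup>2\<close> turns the factorization into a polynomial
  identity in s.\<close>

lemma real_derivative_euler_factor:
  fixes h h' :: "real \<Rightarrow> real"
  assumes r: "r > 0" and hpos: "h r > 0"
    and dh: "(h has_real_derivative h' r) (at r)"
    and dh': "(h' has_real_derivative h'') (at r)"
    and ode: "2 * r\<^sup>2 * h r * h'' =
        (s\<^sup>2 - 1) * h r * (h r - 1) + r * h' r * (r * h' r - lam * r - (s\<^sup>2 - 1))"
  shows "((\<lambda>r. (r * h' r - (1 - s) * h r - lam * r - (s\<^sup>2 - 1)) / (2 * sqrt (h r)))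
      has_real_derivative
        ((1 + s) / 2 * ((r * h' r - (1 - s) * h r - lam * r - (s\<^sup>2 - 1)) / (2 * sqrt (h r)))
          + (s - 1) / 4 * (lam * r + s * (s + 1)) / sqrt (h r)) / r) (at r)"
proof -
  define q where "q = sqrt (h r)"
  define N where "N = r * h' r - (1 - s) * h r - lam * r - (s\<^sup>2 - 1)"
  define N' where "N' = h' r + r * h'' - (1 - s) * h' r - lam"
  have q: "q > 0" "q\<^sup>2 = h r"
    using hpos by (simp_all add: q_def)
  have "((\<lambda>r. (r * h' r - (1 - s) * h r - lam * r - (s\<^sup>2 - 1)) / (2 * sqrt (h r)))
      has_real_derivative (N' * (2 * q) - N * (2 * (h' r * (inverse q / 2)))) / (2 * q * (2 * q))) (at r)"
    unfolding N_def N'_def q_def using hpos dh dh'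
    by (auto intro!: derivative_eq_intros simp: algebra_simps)
  moreover have "(N' * (2 * q) - N * (2 * (h' r * (inverse q / 2)))) / (2 * q * (2 * q))
      = ((1 + s) / 2 * (N / (2 * q)) + (s - 1) / 4 * (lam * r + s * (s + 1)) / q) / r"
  proof -
    have ode': "2 * r\<^sup>2 * q\<^sup>2 * h'' =
        (s\<^sup>2 - 1) * q\<^sup>2 * (q\<^sup>2 - 1) + r * h' r * (r * h' r - lam * r - (s\<^sup>2 - 1))"
      using ode q by simp
    have N_eq: "N = r * h' r - (1 - s) * q\<^sup>2 - lam * r - (s\<^sup>2 - 1)"
      using q by (simp add: N_def)
    \<comment> \<open>This is the claim cleared of denominators. The term
      \<open>2 * r\<^sup>2 * q\<^sup>2 * h''\<close> on the left is replaced through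
      \<open>ode'\<close>; its square of \<open>r * h' r\<close> cancels against the one in
      \<open>N * (r * h' r)\<close>, and a ring identity remains.\<close>
    have "r * (2 * N' * q\<^sup>2 - N * h' r)
        = (1 + s) * N * q\<^sup>2 + (s - 1) * (lam * r + s * (s + 1)) * q\<^sup>2"
      unfolding N_eq N'_def using ode' by algebra
    moreover have "(N' * (2 * q) - N * (2 * (h' r * (inverse q / 2)))) / (2 * q * (2 * q))
        = r * (2 * N' * q\<^sup>2 - N * h' r) / (4 * q ^ 3 * r)"
      using q(1) r by (simp add: field_simps power2_eq_square power3_eq_cube)
    moreover have "((1 + s) / 2 * (N / (2 * q)) + (s - 1) / 4 * (lam * r + s * (s + 1)) / q) / r
        = ((1 + s) * N * q\<^sup>2 + (s - 1) * (lam * r + s * (s + 1)) * q\<^sup>2) / (4 * q ^ 3 * r)"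
      using q(1) r by (simp add: field_simps power2_eq_square power3_eq_cube)
    ultimately show ?thesis by simp
  qed
  ultimately show ?thesis by (simp add: N_def q_def)
qed

text \<open>Compute the limit of ln (r^\<alpha> h) / (- ln r) twice. The numerator converges to ln
  c, so the limit is 0; l'Hopital's rule gives - \<alpha> - b.\<close>

lemma power_exponent_eq_log_derivative_limit:
  fixes h h' :: "real \<Rightarrow> real"
  assumes hpos: "\<forall>\<^sub>F r in at_right 0. h r > 0"
    and dh: "\<forall>\<^sub>F r in at_right 0. (h has_real_derivative h' r) (at r)"
    and lim: "((\<lambda>r. r powr \<alpha> * h r) \<longlongrightarrow> c) (at_right 0)" and c: "c > 0"
    and log_lim: "((\<lambda>r. r * h' r / h r) \<longlongrightarrow> b) (at_right 0)"
  shows "b = - \<alpha>"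
proof -
  have pos: "\<forall>\<^sub>F r in at_right (0::real). r > 0"
    by (rule eventually_at_right_less)
  define f where "f = (\<lambda>r. \<alpha> * ln r + ln (h r))"
  have "((\<lambda>r. f r / - ln r) \<longlongrightarrow> - \<alpha> - b) (at_right 0)"
  \<comment> \<open>The rule wants a denominator tending to plus infinity, hence
    \<open>- ln r\<close>.\<close>
  proof (rule lhopital_right_at_top)
    show "LIM x at_right (0::real). - ln x :> at_top"
      using ln_at_0 by (rule filterlim_uminus_at_bot[THEN iffD1])
    show "\<forall>\<^sub>F x in at_right 0. - (1 / x) \<noteq> (0::real)"
      using pos by eventually_elim simp
    show "\<forall>\<^sub>F x in at_right 0. (f has_real_derivative \<alpha> / x + h' x / h x) (at x)"
      using pos hpos dh
      by eventually_elim (auto simp: f_def intro!: derivative_eq_intros)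
    show "\<forall>\<^sub>F x in at_right (0::real). ((\<lambda>x. - ln x) has_real_derivative - (1 / x)) (at x)"
      using pos by eventually_elim (auto intro!: derivative_eq_intros)
    have "((\<lambda>r. - \<alpha> - r * h' r / h r) \<longlongrightarrow> - \<alpha> - b) (at_right 0)"
      by (intro tendsto_intros log_lim)
    then show "((\<lambda>x. (\<alpha> / x + h' x / h x) / - (1 / x)) \<longlongrightarrow> - \<alpha> - b) (at_right 0)"
      by (rule Lim_transform_eventually)
        (use pos hpos in eventually_elim, simp add: field_simps)
  qed
  moreover have "((\<lambda>r. f r / - ln r) \<longlongrightarrow> 0) (at_right 0)"
  proof -
    have "((\<lambda>r. ln (r powr \<alpha> * h r)) \<longlongrightarrow> ln c) (at_right 0)"
      using lim c by (intro tendsto_ln) auto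
    then have "(f \<longlongrightarrow> ln c) (at_right 0)"
      by (rule Lim_transform_eventually)
        (use pos hpos in eventually_elim, simp add: f_def ln_mult ln_powr)
    moreover have "filterlim (\<lambda>x. - ln x) at_infinity (at_right (0::real))"
      by (intro filterlim_at_top_imp_at_infinity filterlim_uminus_at_bot[THEN iffD1] ln_at_0)
    ultimately show ?thesis
      by (rule tendsto_divide_0)
  qed
  ultimately have "- \<alpha> - b = 0"
    using tendsto_unique trivial_limit_at_right_real by blast
  then show ?thesis by simp
qed

theorem theorem1p4:
  fixes n :: nat and lam \<epsilon> c\<^sub>0 \<alpha> :: real and h :: "real \<Rightarrow> real"
  assumes "n \<ge> 2" and "\<epsilon> > 0" and "c\<^sub>0 > 0"
    and "C2_on {0<..<\<epsilon>} h"
    and "\<And>r. r \<in> {0<..<\<epsilon>} \<Longrightarrow> h r > 0"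
    and "\<And>r. r \<in> {0<..<\<epsilon>} \<Longrightarrow>
           2 * r\<^sup>2 * h r * deriv (deriv h) r =
             (real n - 1) * h r * (h r - 1)
             + r * deriv h r * (r * deriv h r - lam * r - (real n - 1))"
    and "\<alpha> > 0"
    and "((\<lambda>r. r powr \<alpha> * h r) \<longlongrightarrow> c\<^sub>0) (at_right 0)"
  shows "\<alpha> = sqrt (real n) - 1"
proof -
  define s where "s = sqrt (real n)"
  have s: "s\<^sup>2 = real n" "s > 0"
    using assms(1) by (simp_all add: s_def)
  define v where "v = (\<lambda>r. (r * deriv h r - (1 - s) * h r - lam * r - (s\<^sup>2 - 1)) / (2 * sqrt (h r)))"
  define w where "w = (\<lambda>r. (s - 1) / 4 * (lam * r + s * (s + 1)) / sqrt (h r))"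
  have dh: "(h has_real_derivative deriv h r) (at r)"
    and dh': "(deriv h has_real_derivative deriv (deriv h) r) (at r)" if "r \<in> {0<..<\<epsilon>}" for r
    using assms(4) that by (auto simp: C2_on_def intro: field_differentiable_derivI)
  have dv: "(v has_real_derivative ((1 + s) / 2 * v r + w r) / r) (at r)" if "r \<in> {0<..<\<epsilon>}" for r
    unfolding v_def w_def
    by (rule real_derivative_euler_factor[OF _ assms(5)[OF that] dh[OF that] dh'[OF that]])
      (use that assms(6)[OF that] s in auto)
  have near: "\<forall>\<^sub>F r in at_right 0. r \<in> {0<..<\<epsilon>}"
    using assms(2) by (rule eventually_at_right_real)
  have hpos: "\<forall>\<^sub>F r in at_right 0. h r > 0"
    using near by eventually_elim (rule assms(5))
  have id: "((\<lambda>r::real. r) \<longlongrightarrow> 0) (at_right 0)"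
    by (rule tendsto_ident_at)
  \<comment> \<open>Blow-up of h: 1/h is r^\<alpha> divided by r^\<alpha> h, where the numerator
    tends to 0 as \<alpha> > 0 and the denominator to a positive limit.\<close>
  have inv_h: "((\<lambda>r. 1 / h r) \<longlongrightarrow> 0) (at_right 0)"
  proof -
    have "((\<lambda>r::real. r powr \<alpha>) \<longlongrightarrow> 0) (at_right 0)"
      using assms(7) id by (intro tendsto_zero_powrI[where b = \<alpha>]) (auto intro: eventually_mono[OF near])
    then have "((\<lambda>r. r powr \<alpha> / (r powr \<alpha> * h r)) \<longlongrightarrow> 0 / c\<^sub>0) (at_right 0)"
      using assms(3,8) by (intro tendsto_divide) auto
    then have "((\<lambda>r. r powr \<alpha> / (r powr \<alpha> * h r)) \<longlongrightarrow> 0) (at_right 0)"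
      by simp
    then show ?thesis
      by (rule Lim_transform_eventually) (use near in eventually_elim, simp)
  qed
  have inv_sqrt_h: "((\<lambda>r. 1 / sqrt (h r)) \<longlongrightarrow> 0) (at_right 0)"
    using tendsto_real_sqrt[OF inv_h] by (simp add: real_sqrt_divide)
  have "(w \<longlongrightarrow> (s - 1) / 4 * (lam * 0 + s * (s + 1)) * 0) (at_right 0)"
    unfolding w_def divide_inverse[of _ "sqrt _"]
    by (intro tendsto_intros id inv_sqrt_h[unfolded divide_inverse mult_1])
  then have "\<forall>\<^sub>F r in at_right 0. \<bar>w r\<bar> < 1"
    using tendstoD[of w 0 "at_right 0" 1] by (simp add: dist_real_def)
  with near have "\<forall>\<^sub>F r in at_right 0. r \<in> {0<..<\<epsilon>} \<and> \<bar>w r\<bar> < 1"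
    by eventually_elim simp
  then obtain b where b: "b > 0" "\<And>r. \<lbrakk>0 < r; r < b\<rbrakk> \<Longrightarrow> r \<in> {0<..<\<epsilon>} \<and> \<bar>w r\<bar> < 1"
    unfolding eventually_at_right_field by blast
  \<comment> \<open>The boundedness lemma needs its hypotheses up to and including the endpoint,
    while \<open>b\<close> only serves r < b.\<close>
  define d where "d = b / 2"
  have d: "d > 0" "d < b" using b(1) by (simp_all add: d_def)
  \<comment> \<open>Here m = (1 + s)/2 and K = 1: by \<open>dv\<close>, r v' - m v is exactly
    \<open>w r\<close>.\<close>
  have v_bounded: "\<bar>v r\<bar> \<le> \<bar>v d\<bar> + 1 / ((1 + s) / 2)" if r: "0 < r" "r \<le> d" for r
  proof (rule euler_first_order_bounded[OF _ _ _ r])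
    show "(1 + s) / 2 > 0" using s by simp
    fix x assume x: "0 < x" "x \<le> d"
    with d have x': "x \<in> {0<..<\<epsilon>}" "\<bar>w x\<bar> < 1" using b(2)[of x] by auto
    show "(v has_real_derivative ((1 + s) / 2 * v x + w x) / x) (at x)"
      by (rule dv[OF x'(1)])
    show "\<bar>x * (((1 + s) / 2 * v x + w x) / x) - (1 + s) / 2 * v x\<bar> \<le> 1"
      using x x' by simp
  qed
  have "((\<lambda>r. 1 / sqrt (h r) * v r) \<longlongrightarrow> 0) (at_right 0)"
  proof -
    have "\<forall>\<^sub>F r in at_right 0. r \<in> {0<..<d}"
      using d(1) by (rule eventually_at_right_real)
    then have "Bfun v (at_right 0)"
      using v_bounded by (intro BfunI[where K = "\<bar>v d\<bar> + 1 / ((1 + s) / 2)"]) (auto elim: eventually_mono)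
    with inv_sqrt_h show ?thesis
      using bounded_bilinear.Zfun_prod_Bfun[OF bounded_bilinear_mult, of "\<lambda>r. 1 / sqrt (h r)"]
      by (simp add: tendsto_Zfun_iff)
  qed
  \<comment> \<open>The expression is r h' / h, obtained by solving the definition of
    \<open>v\<close> for r h' and dividing by h; only the constant 1 - s survives in the
    limit.\<close>
  then have "((\<lambda>r. (1 - s) + (lam * r + (s\<^sup>2 - 1)) * (1 / h r) + 2 * (1 / sqrt (h r) * v r)) \<longlongrightarrow>
      (1 - s) + (lam * 0 + (s\<^sup>2 - 1)) * 0 + 2 * 0) (at_right 0)"
    by (intro tendsto_intros id inv_h)
  then have "((\<lambda>r. (1 - s) + (lam * r + (s\<^sup>2 - 1)) * (1 / h r) + 2 * (1 / sqrt (h r) * v r)) \<longlongrightarrow> 1 - s)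
      (at_right 0)"
    by simp
  then have "((\<lambda>r. r * deriv h r / h r) \<longlongrightarrow> 1 - s) (at_right 0)"
  proof (rule Lim_transform_eventually)
    show "\<forall>\<^sub>F r in at_right 0. (1 - s) + (lam * r + (s\<^sup>2 - 1)) * (1 / h r)
        + 2 * (1 / sqrt (h r) * v r) = r * deriv h r / h r"
      using hpos
    proof eventually_elim
      case (elim r)
      \<comment> \<open>Used with q = sqrt (h r), so that q * q collapses to h r; at q = 0 both
        sides are 0 by the convention for division.\<close>
      have "2 * (1 / q * (N / (2 * q))) = N / (q * q)" for N q :: real
        by (cases "q = 0") (simp_all add: field_simps)
      with elim have "2 * (1 / sqrt (h r) * v r)
          = (r * deriv h r - (1 - s) * h r - lam * r - (s\<^sup>2 - 1)) / h r"
        unfolding v_def by (simp only: real_sqrt_mult_self abs_of_pos)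
      with elim show ?case by (simp add: field_simps)
    qed
  qed
  moreover have "\<forall>\<^sub>F r in at_right 0. (h has_real_derivative deriv h r) (at r)"
    using near by eventually_elim (rule dh)
  ultimately have "1 - s = - \<alpha>"
    using power_exponent_eq_log_derivative_limit hpos assms(3,8) by blast
  then show ?thesis by (simp add: s_def)
qed

end
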